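(* For every set of formulas $\Gamma\cup\{\varphi\}\subseteq\mathbf F(\Sigma_{\mathbf{nbI}},\mathcal V)$: $\Gamma\vDash_{\mathbf{nbI}}\varphi$ if and only if $\Gamma\vDash_{\mathcal M^{\mathbf 2}_{\mathbf{nbI}}}\varphi$. Hence, $\Gamma\vdash_{\mathbf{nbI}}\varphi$ if and only if $\Gamma\vDash_{\mathcal M^{\mathbf 2}_{\mathbf{nbI}}}\varphi$.
   Context: Let $\mathcal V$ be a countable set of propositional variables and $\Sigma_{\mathbf{nbI}}=\{\vee,\wedge,\rightarrow,\uparrow,\neg\}$ with $\neg$ unary and the other connectives binary; $\mathbf F(\Sigma_{\mathbf{nbI}},\mathcal V)$ is the set of formulas. The logic $\mathbf{nbI}$ is the Hilbert calculus whose only inference rule is Modus Ponens and whose axioms are all instances (with arbitrary formulas) of: (1) $\alpha\to(\beta\to\alpha)$; (2) $(\alpha\to(\beta\to\gamma))\to((\alpha\to\beta)\to(\alpha\to\gamma))$; (3) $\alpha\to(\beta\to(\alpha\wedge\beta))$; (4) $(\alpha\wedge\beta)\to\alpha$; (5) $(\alpha\wedge\beta)\to\beta$; (6) $\alpha\to(\alpha\vee\beta)$; (7) $\beta\to(\alpha\vee\beta)$; (8) $(\alpha\to\gamma)\to((\beta\to\gamma)\to((\alpha\vee\beta)\to\gamma))$; (9) $(\alpha\to\beta)\vee\alpha$; (Ip) $(\alpha\uparrow\beta)\to(\alpha\to(\beta\to\gamma))$; (Comm) $(\alpha\uparrow\beta)\to(\beta\uparrow\alpha)$; (11) $\alpha\vee\neg\alpha$.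 $\Gamma\vdash_{\mathbf{nbI}}\varphi$ means that there is a finite derivation of $\varphi$ from premises in $\Gamma$. A bivaluation for $\mathbf{nbI}$ is a map $\nu:\mathbf F(\Sigma_{\mathbf{nbI}},\mathcal V)\to\{0,1\}$ such that for all formulas $\alpha,\beta$: $\nu(\alpha\vee\beta)=1$ iff $\nu(\alpha)=1$ or $\nu(\beta)=1$; $\nu(\alpha\wedge\beta)=1$ iff $\nu(\alpha)=\nu(\beta)=1$; $\nu(\alpha\to\beta)=1$ iff $\nu(\alpha)=0$ or $\nu(\beta)=1$; if $\nu(\alpha\uparrow\beta)=1$ then $\nu(\alpha)=0$ or $\nu(\beta)=0$; $\nu(\alpha\uparrow\beta)=\nu(\beta\uparrow\alpha)$; if $\nu(\neg\alpha)=0$ then $\nu(\alpha)=1$. $\Gamma\vDash_{\mathbf{nbI}}\varphi$ means: for every bivaluation $\nu$ for $\mathbf{nbI}$, if $\nu(\gamma)=1$ for all $\gamma\in\Gamma$ then $\nu(\varphi)=1$. Let $\mathbf 2_{\mathbf{nbI}}$ be the multialgebra with universe $\{0,1\}$ in which $\vee,\wedge,\to$ are the usual (deterministic) Boolean operations, $\uparrow$ is the multioperation $1\uparrow1=\{0\}$, $x\uparrow y=\{0,1\}$ otherwise, and $\neg0=\{1\}$, $\neg1=\{0,1\}$. A valuation over $\mathbf 2_{\mathbf{nbI}}$ is a map $\nu:\mathbf F(\Sigma_{\mathbf{nbI}},\mathcal V)\to\{0,1\}$ with $\nu(\alpha\#\beta)=\nu(\alpha)\#\nu(\beta)$ for $\#\in\{\vee,\wedge,\to\}$,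 $\nu(\alpha\uparrow\beta)\in\nu(\alpha)\uparrow\nu(\beta)$ and $\nu(\neg\alpha)\in\neg\nu(\alpha)$. The restricted non-deterministic matrix $\mathcal M^{\mathbf 2}_{\mathbf{nbI}}=(\mathbf 2_{\mathbf{nbI}},\{1\},\mathcal F_{\mathbf 2_{\mathbf{nbI}}})$ has $\mathcal F_{\mathbf 2_{\mathbf{nbI}}}$ equal to the set of all valuations $\nu$ over $\mathbf 2_{\mathbf{nbI}}$ with $\nu(\alpha\uparrow\beta)=\nu(\beta\uparrow\alpha)$ for all formulas $\alpha,\beta$. $\Gamma\vDash_{\mathcal M^{\mathbf 2}_{\mathbf{nbI}}}\varphi$ means: for every $\nu\in\mathcal F_{\mathbf 2_{\mathbf{nbI}}}$, if $\nu(\gamma)=1$ for all $\gamma\in\Gamma$ then $\nu(\varphi)=1$. *)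

theory Defs
  imports "HOL-Library.Countable"
begin

datatype 'v fm =
    Var 'v
  | Disj "'v fm" "'v fm"  (infixr \<open>\<^bold>\<or>\<close> 65)
  | Conj "'v fm" "'v fm"  (infixr \<open>\<^bold>\<and>\<close> 70)
  | Impl "'v fm" "'v fm"  (infixr \<open>\<^bold>\<rightarrow>\<close> 60)
  | Incomp "'v fm" "'v fm"  (infix \<open>\<^bold>\<up>\<close> 75)
  | Neg "'v fm"  (\<open>\<^bold>\<not> _\<close> [80] 80)


subsection \<open>The Hilbert calculus\<close>

inductive nbI_axiom :: "'v fm \<Rightarrow> bool" where
  K: "nbI_axiom (\<alpha> \<^bold>\<rightarrow> (\<beta> \<^bold>\<rightarrow> \<alpha>))"
| S: "nbI_axiom ((\<alpha> \<^bold>\<rightarrow> (\<beta> \<^bold>\<rightarrow> \<gamma>)) \<^bold>\<rightarrow> ((\<alpha> \<^bold>\<rightarrow> \<beta>) \<^bold>\<rightarrow> (\<alpha> \<^bold>\<rightarrow> \<gamma>)))"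
| ConjI: "nbI_axiom (\<alpha> \<^bold>\<rightarrow> (\<beta> \<^bold>\<rightarrow> (\<alpha> \<^bold>\<and> \<beta>)))"
| ConjE1: "nbI_axiom ((\<alpha> \<^bold>\<and> \<beta>) \<^bold>\<rightarrow> \<alpha>)"
| ConjE2: "nbI_axiom ((\<alpha> \<^bold>\<and> \<beta>) \<^bold>\<rightarrow> \<beta>)"
| DisjI1: "nbI_axiom (\<alpha> \<^bold>\<rightarrow> (\<alpha> \<^bold>\<or> \<beta>))"
| DisjI2: "nbI_axiom (\<beta> \<^bold>\<rightarrow> (\<alpha> \<^bold>\<or> \<beta>))"
| DisjE: "nbI_axiom ((\<alpha> \<^bold>\<rightarrow> \<gamma>) \<^bold>\<rightarrow> ((\<beta> \<^bold>\<rightarrow> \<gamma>) \<^bold>\<rightarrow> ((\<alpha> \<^bold>\<or> \<beta>) \<^bold>\<rightarrow> \<gamma>)))"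
| ImplDisj: "nbI_axiom ((\<alpha> \<^bold>\<rightarrow> \<beta>) \<^bold>\<or> \<alpha>)"
| Ip: "nbI_axiom ((\<alpha> \<^bold>\<up> \<beta>) \<^bold>\<rightarrow> (\<alpha> \<^bold>\<rightarrow> (\<beta> \<^bold>\<rightarrow> \<gamma>)))"
| Comm: "nbI_axiom ((\<alpha> \<^bold>\<up> \<beta>) \<^bold>\<rightarrow> (\<beta> \<^bold>\<up> \<alpha>))"
| ExcMid: "nbI_axiom (\<alpha> \<^bold>\<or> \<^bold>\<not> \<alpha>)"

definition nbI_derivation :: "'v fm set \<Rightarrow> 'v fm list \<Rightarrow> bool" where
  "nbI_derivation \<Gamma> ps \<longleftrightarrow>
    (\<forall>i < length ps. ps ! i \<in> \<Gamma> \<or> nbI_axiom (ps ! i) \<or>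
      (\<exists>j < i. \<exists>k < i. ps ! k = (ps ! j \<^bold>\<rightarrow> ps ! i)))"

definition nbI_derives :: "'v fm set \<Rightarrow> 'v fm \<Rightarrow> bool"  (infix \<open>\<turnstile>\<^sub>n\<^sub>b\<^sub>I\<close> 50) where
  "\<Gamma> \<turnstile>\<^sub>n\<^sub>b\<^sub>I \<phi> \<longleftrightarrow> (\<exists>ps. ps \<noteq> [] \<and> nbI_derivation \<Gamma> ps \<and> last ps = \<phi>)"


subsection \<open>Bivaluations\<close>

text \<open>The truth values 1 and 0 are \<^const>\<open>True\<close> and \<^const>\<open>False\<close>, here and below.\<close>

definition nbI_bivaluation :: "('v fm \<Rightarrow> bool) \<Rightarrow> bool" where
  "nbI_bivaluation \<nu> \<longleftrightarrow>
    (\<forall>\<alpha> \<beta>.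
      (\<nu> (\<alpha> \<^bold>\<or> \<beta>) \<longleftrightarrow> \<nu> \<alpha> \<or> \<nu> \<beta>) \<and>
      (\<nu> (\<alpha> \<^bold>\<and> \<beta>) \<longleftrightarrow> \<nu> \<alpha> \<and> \<nu> \<beta>) \<and>
      (\<nu> (\<alpha> \<^bold>\<rightarrow> \<beta>) \<longleftrightarrow> \<not> \<nu> \<alpha> \<or> \<nu> \<beta>) \<and>
      (\<nu> (\<alpha> \<^bold>\<up> \<beta>) \<longrightarrow> \<not> \<nu> \<alpha> \<or> \<not> \<nu> \<beta>) \<and>
      \<nu> (\<alpha> \<^bold>\<up> \<beta>) = \<nu> (\<beta> \<^bold>\<up> \<alpha>) \<and>
      (\<not> \<nu> (\<^bold>\<not> \<alpha>) \<longrightarrow> \<nu> \<alpha>))"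

definition nbI_entails :: "'v fm set \<Rightarrow> 'v fm \<Rightarrow> bool"  (infix \<open>\<Turnstile>\<^sub>n\<^sub>b\<^sub>I\<close> 50) where
  "\<Gamma> \<Turnstile>\<^sub>n\<^sub>b\<^sub>I \<phi> \<longleftrightarrow> (\<forall>\<nu>. nbI_bivaluation \<nu> \<longrightarrow> (\<forall>\<gamma>\<in>\<Gamma>. \<nu> \<gamma>) \<longrightarrow> \<nu> \<phi>)"


subsection \<open>Restricted non-deterministic matrices\<close>

text \<open>The universe of a multialgebra is the whole type \<^typ>\<open>'a\<close>. A deterministic operation is a
  multioperation whose values are singletons; for it the membership condition of
  \<open>valuation_over\<close> is the usual homomorphism equation.\<close>

record 'a multialgebra =
  disj_op :: "'a \<Rightarrow> 'a \<Rightarrow> 'a set"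
  conj_op :: "'a \<Rightarrow> 'a \<Rightarrow> 'a set"
  impl_op :: "'a \<Rightarrow> 'a \<Rightarrow> 'a set"
  incomp_op :: "'a \<Rightarrow> 'a \<Rightarrow> 'a set"
  neg_op :: "'a \<Rightarrow> 'a set"

definition valuation_over :: "'a multialgebra \<Rightarrow> ('v fm \<Rightarrow> 'a) \<Rightarrow> bool" where
  "valuation_over A \<nu> \<longleftrightarrow>
    (\<forall>\<alpha> \<beta>.
      \<nu> (\<alpha> \<^bold>\<or> \<beta>) \<in> disj_op A (\<nu> \<alpha>) (\<nu> \<beta>) \<and>
      \<nu> (\<alpha> \<^bold>\<and> \<beta>) \<in> conj_op A (\<nu> \<alpha>) (\<nu> \<beta>) \<and>
      \<nu> (\<alpha> \<^bold>\<rightarrow> \<beta>) \<in> impl_op A (\<nu> \<alpha>) (\<nu> \<beta>) \<and>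
      \<nu> (\<alpha> \<^bold>\<up> \<beta>) \<in> incomp_op A (\<nu> \<alpha>) (\<nu> \<beta>) \<and>
      \<nu> (\<^bold>\<not> \<alpha>) \<in> neg_op A (\<nu> \<alpha>))"

record ('v, 'a) rnmatrix =
  algebra_of :: "'a multialgebra"
  designated :: "'a set"
  valuations :: "('v fm \<Rightarrow> 'a) set"

definition rnmatrix_entails :: "'v fm set \<Rightarrow> ('v, 'a) rnmatrix \<Rightarrow> 'v fm \<Rightarrow> bool"
    (\<open>_ \<Turnstile>[_] _\<close> [51, 0, 51] 50) where
  "\<Gamma> \<Turnstile>[M] \<phi> \<longleftrightarrow>
    (\<forall>\<nu>\<in>valuations M. (\<forall>\<gamma>\<in>\<Gamma>. \<nu> \<gamma> \<in> designated M) \<longrightarrow> \<nu> \<phi> \<in> designated M)"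

definition two_nbI :: "bool multialgebra" where
  "two_nbI =
    \<lparr> disj_op = (\<lambda>x y. {x \<or> y}),
      conj_op = (\<lambda>x y. {x \<and> y}),
      impl_op = (\<lambda>x y. {x \<longrightarrow> y}),
      incomp_op = (\<lambda>x y. if x \<and> y then {False} else {False, True}),
      neg_op = (\<lambda>x. if x then {False, True} else {True}) \<rparr>"

definition valuations_two_nbI :: "('v fm \<Rightarrow> bool) set" where
  "valuations_two_nbI =
    {\<nu>. valuation_over two_nbI \<nu> \<and> (\<forall>\<alpha> \<beta>. \<nu> (\<alpha> \<^bold>\<up> \<beta>) = \<nu> (\<beta> \<^bold>\<up> \<alpha>))}"

definition M2_nbI :: "('v, bool) rnmatrix" where
  "M2_nbI =
    \<lparr> algebra_of = two_nbI, designated = {True}, valuations = valuations_two_nbI \<rparr>"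

end

theory Submission
  imports Defs
begin

text \<open>The first equivalence holds because the clauses for bivaluations and the multioperations
  of \<open>two_nbI\<close> are two descriptions of the same maps: a multioperation lists exactly those values which the
  bivaluation clause does not exclude, and commutativity of \<open>\<up>\<close>, which no multioperation can
  enforce since it relates the values of two different formulas, is imposed on both sides
  separately (\<open>valuations_two_nbI_eq\<close>).

  Given this, the second equivalence is soundness and completeness of the calculus for bivaluations.
  Soundness is an induction on derivations. Completeness is the Lindenbaum--Asser argument: if \<open>\<Gamma>\<close>
  does not derive \<open>\<phi>\<close>, Zorn's lemma extends \<open>\<Gamma>\<close> to a set \<open>\<Delta>\<close> maximal among those not deriving \<open>\<phi>\<close>
  (\<open>lindenbaum\<close>). Maximality is taken relative to \<open>\<phi>\<close>, and not as maximal consistency, because a formula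
  and its negation may be true together, so \<open>\<not>\<alpha> \<in> \<Delta>\<close> does not express \<open>\<alpha> \<notin> \<Delta>\<close>. What does express it,
  by the deduction theorem, is \<open>\<Delta> \<turnstile> \<alpha> \<rightarrow> \<phi>\<close>. Hence \<open>\<Delta>\<close> is deductively closed and prime, and
  the axioms make its characteristic function a bivaluation (\<open>saturated_bivaluation\<close>), which satisfies
  \<open>\<Gamma>\<close> and refutes \<open>\<phi>\<close>.\<close>

section \<open>Derivability as an inductive closure\<close>

lemma nbI_derivation_snoc:
  "nbI_derivation \<Gamma> (ps @ [\<alpha>]) \<longleftrightarrow> nbI_derivation \<Gamma> ps \<and>
    (\<alpha> \<in> \<Gamma> \<or> nbI_axiom \<alpha> \<or> (\<exists>\<beta> \<in> set ps. (\<beta> \<^bold>\<rightarrow> \<alpha>) \<in> set ps))"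
proof -
  define step where "step qs i \<longleftrightarrow> qs ! i \<in> \<Gamma> \<or> nbI_axiom (qs ! i) \<or>
      (\<exists>j < i. \<exists>k < i. qs ! k = (qs ! j \<^bold>\<rightarrow> qs ! i))" for qs :: "'a fm list" and i
  have derivation_iff: "nbI_derivation \<Gamma> qs \<longleftrightarrow> (\<forall>i < length qs. step qs i)" for qs
    by (simp only: nbI_derivation_def step_def)
  have init: "step (ps @ [\<alpha>]) i \<longleftrightarrow> step ps i" if "i < length ps" for i
    using that by (simp add: step_def nth_append cong: conj_cong)
  have "(\<exists>j < length ps. \<exists>k < length ps. ps ! k = (ps ! j \<^bold>\<rightarrow> \<alpha>))
      \<longleftrightarrow> (\<exists>\<beta> \<in> set ps. (\<beta> \<^bold>\<rightarrow> \<alpha>) \<in> set ps)" (is "?L \<longleftrightarrow> ?R")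
  proof
    assume ?L
    then obtain j k where "j < length ps" "k < length ps" "ps ! k = (ps ! j \<^bold>\<rightarrow> \<alpha>)"
      by blast
    then have "ps ! j \<in> set ps" and "(ps ! j \<^bold>\<rightarrow> \<alpha>) \<in> set ps"
      by (simp_all flip: \<open>ps ! k = _\<close>)
    then show ?R by blast
  next
    assume ?R
    then obtain j k where "j < length ps" "k < length ps" "ps ! k = (ps ! j \<^bold>\<rightarrow> \<alpha>)"
      by (auto simp: in_set_conv_nth)
    then show ?L by blast
  qed
  then have last: "step (ps @ [\<alpha>]) (length ps) \<longleftrightarrow>
      \<alpha> \<in> \<Gamma> \<or> nbI_axiom \<alpha> \<or> (\<exists>\<beta> \<in> set ps. (\<beta> \<^bold>\<rightarrow> \<alpha>) \<in> set ps)"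
    by (simp add: step_def nth_append cong: conj_cong)
  show ?thesis
    unfolding derivation_iff length_append_singleton All_less_Suc last
    by (simp only: init conj_commute cong: imp_cong)
qed

lemma nbI_derivation_append:
  assumes "nbI_derivation \<Gamma> ps" and "nbI_derivation \<Gamma> qs"
  shows "nbI_derivation \<Gamma> (ps @ qs)"
  using assms(2)
proof (induction qs rule: rev_induct)
  case Nil
  with assms(1) show ?case by simp
next
  case (snoc \<alpha> qs)
  then show ?case
    unfolding append_assoc[symmetric] nbI_derivation_snoc by auto
qed

lemma derives_premise: "\<alpha> \<in> \<Gamma> \<Longrightarrow> \<Gamma> \<turnstile>\<^sub>n\<^sub>b\<^sub>I \<alpha>"
  unfolding nbI_derives_def by (rule exI[of _ "[\<alpha>]"]) (simp add: nbI_derivation_def)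

lemma derives_axiom: "nbI_axiom \<alpha> \<Longrightarrow> \<Gamma> \<turnstile>\<^sub>n\<^sub>b\<^sub>I \<alpha>"
  unfolding nbI_derives_def by (rule exI[of _ "[\<alpha>]"]) (simp add: nbI_derivation_def)

lemma derives_mp:
  assumes "\<Gamma> \<turnstile>\<^sub>n\<^sub>b\<^sub>I \<alpha> \<^bold>\<rightarrow> \<beta>" and "\<Gamma> \<turnstile>\<^sub>n\<^sub>b\<^sub>I \<alpha>"
  shows "\<Gamma> \<turnstile>\<^sub>n\<^sub>b\<^sub>I \<beta>"
proof -
  obtain ps qs where ps: "ps \<noteq> []" "nbI_derivation \<Gamma> ps" "last ps = \<alpha> \<^bold>\<rightarrow> \<beta>"
    and qs: "qs \<noteq> []" "nbI_derivation \<Gamma> qs" "last qs = \<alpha>"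
    using assms unfolding nbI_derives_def by blast
  have "\<alpha> \<^bold>\<rightarrow> \<beta> \<in> set (ps @ qs)" and "\<alpha> \<in> set (ps @ qs)"
    using ps(1,3) qs(1,3) last_in_set by fastforce+
  then have "nbI_derivation \<Gamma> ((ps @ qs) @ [\<beta>])"
    using nbI_derivation_append[OF ps(2) qs(2)] unfolding nbI_derivation_snoc by blast
  then show ?thesis
    unfolding nbI_derives_def by (intro exI[of _ "(ps @ qs) @ [\<beta>]"]) simp
qed

text \<open>With the three closure rules above, this makes \<open>\<turnstile>\<close> the least set of formulas that
  contains premises and axioms and is closed under Modus Ponens, so that no later argument
  has to look at the positions in a derivation.\<close>

lemma derives_induct [consumes 1, case_names premise axiom mp]:
  assumes "\<Gamma> \<turnstile>\<^sub>n\<^sub>b\<^sub>I \<phi>"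
    and premise: "\<And>\<alpha>. \<alpha> \<in> \<Gamma> \<Longrightarrow> P \<alpha>"
    and "axiom": "\<And>\<alpha>. nbI_axiom \<alpha> \<Longrightarrow> P \<alpha>"
    and mp: "\<And>\<alpha> \<beta>. P (\<alpha> \<^bold>\<rightarrow> \<beta>) \<Longrightarrow> P \<alpha> \<Longrightarrow> P \<beta>"
  shows "P \<phi>"
proof -
  obtain ps where ps: "ps \<noteq> []" "nbI_derivation \<Gamma> ps" "last ps = \<phi>"
    using assms(1) unfolding nbI_derives_def by blast
  from ps(2) have "\<forall>\<alpha> \<in> set ps. P \<alpha>"
  proof (induction ps rule: rev_induct)
    case (snoc \<alpha> ps)
    then have "\<forall>\<beta> \<in> set ps. P \<beta>"
      and "\<alpha> \<in> \<Gamma> \<or> nbI_axiom \<alpha> \<or> (\<exists>\<beta> \<in> set ps. (\<beta> \<^bold>\<rightarrow> \<alpha>) \<in> set ps)"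
      unfolding nbI_derivation_snoc by blast+
    then consider "\<alpha> \<in> \<Gamma>" | "nbI_axiom \<alpha>" | \<beta> where "P (\<beta> \<^bold>\<rightarrow> \<alpha>)" "P \<beta>"
      by blast
    then have "P \<alpha>"
      by cases (fact premise, fact "axiom", fact mp)
    with \<open>\<forall>\<beta> \<in> set ps. P \<beta>\<close> show ?case by simp
  qed simp
  with ps show ?thesis by auto
qed

section \<open>Soundness\<close>

lemma nbI_bivaluationD:
  assumes "nbI_bivaluation \<nu>"
  shows "\<nu> (\<alpha> \<^bold>\<or> \<beta>) \<longleftrightarrow> \<nu> \<alpha> \<or> \<nu> \<beta>"
    and "\<nu> (\<alpha> \<^bold>\<and> \<beta>) \<longleftrightarrow> \<nu> \<alpha> \<and> \<nu> \<beta>"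
    and "\<nu> (\<alpha> \<^bold>\<rightarrow> \<beta>) \<longleftrightarrow> \<not> \<nu> \<alpha> \<or> \<nu> \<beta>"
    and "\<nu> (\<alpha> \<^bold>\<up> \<beta>) \<Longrightarrow> \<not> \<nu> \<alpha> \<or> \<not> \<nu> \<beta>"
    and "\<nu> (\<alpha> \<^bold>\<up> \<beta>) = \<nu> (\<beta> \<^bold>\<up> \<alpha>)"
    and "\<not> \<nu> (\<^bold>\<not> \<alpha>) \<Longrightarrow> \<nu> \<alpha>"
  using assms unfolding nbI_bivaluation_def by blast+

lemma nbI_axiom_valid:
  assumes "nbI_axiom \<alpha>" and "nbI_bivaluation \<nu>"
  shows "\<nu> \<alpha>"
  using assms(1)
proof cases
  case (Ip \<alpha> \<beta> \<gamma>)
  then show ?thesis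
    using nbI_bivaluationD(4)[OF assms(2), of \<alpha> \<beta>] by (auto simp: nbI_bivaluationD(3)[OF assms(2)])
next
  case (Comm \<alpha> \<beta>)
  then show ?thesis
    using nbI_bivaluationD(5)[OF assms(2), of \<alpha> \<beta>] by (simp add: nbI_bivaluationD(3)[OF assms(2)])
next
  case (ExcMid \<alpha>)
  then show ?thesis
    using nbI_bivaluationD(6)[OF assms(2), of \<alpha>] by (auto simp: nbI_bivaluationD(1)[OF assms(2)])
qed (auto simp: nbI_bivaluationD(1-3)[OF assms(2)])

lemma nbI_soundness:
  assumes "\<Gamma> \<turnstile>\<^sub>n\<^sub>b\<^sub>I \<phi>"
  shows "\<Gamma> \<Turnstile>\<^sub>n\<^sub>b\<^sub>I \<phi>"
  unfolding nbI_entails_def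
proof (intro allI impI)
  fix \<nu> :: "'a fm \<Rightarrow> bool"
  assume \<nu>: "nbI_bivaluation \<nu>" "\<forall>\<gamma>\<in>\<Gamma>. \<nu> \<gamma>"
  from assms show "\<nu> \<phi>"
  proof (induction rule: derives_induct)
    case (premise \<alpha>)
    with \<nu>(2) show ?case by blast
  next
    case ("axiom" \<alpha>)
    then show ?case using \<nu>(1) by (rule nbI_axiom_valid)
  next
    case (mp \<alpha> \<beta>)
    then show ?case by (simp add: nbI_bivaluationD(3)[OF \<nu>(1)])
  qed
qed

section \<open>Deduction theorem and saturated sets\<close>

lemma derives_weaken: "\<Gamma> \<turnstile>\<^sub>n\<^sub>b\<^sub>I \<beta> \<Longrightarrow> \<Gamma> \<turnstile>\<^sub>n\<^sub>b\<^sub>I \<alpha> \<^bold>\<rightarrow> \<beta>"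
  by (rule derives_mp[OF derives_axiom[OF nbI_axiom.K]])

lemma derives_refl: "\<Gamma> \<turnstile>\<^sub>n\<^sub>b\<^sub>I \<alpha> \<^bold>\<rightarrow> \<alpha>"
proof -
  \<comment> \<open>The classical derivation of \<open>I\<close> as \<open>S K K\<close>, the intermediate formula being \<open>\<alpha> \<rightarrow> \<alpha>\<close>.\<close>
  have "\<Gamma> \<turnstile>\<^sub>n\<^sub>b\<^sub>I (\<alpha> \<^bold>\<rightarrow> (\<alpha> \<^bold>\<rightarrow> \<alpha>)) \<^bold>\<rightarrow> (\<alpha> \<^bold>\<rightarrow> \<alpha>)"
    by (rule derives_mp[OF derives_axiom[OF nbI_axiom.S] derives_axiom[OF nbI_axiom.K]])
  then show ?thesis
    by (rule derives_mp[OF _ derives_axiom[OF nbI_axiom.K]])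
qed

theorem deduction:
  assumes "insert \<alpha> \<Gamma> \<turnstile>\<^sub>n\<^sub>b\<^sub>I \<beta>"
  shows "\<Gamma> \<turnstile>\<^sub>n\<^sub>b\<^sub>I \<alpha> \<^bold>\<rightarrow> \<beta>"
  using assms
proof (induction rule: derives_induct)
  case (premise \<gamma>)
  then consider "\<gamma> = \<alpha>" | "\<gamma> \<in> \<Gamma>" by blast
  then show ?case by cases (simp_all add: derives_refl derives_weaken derives_premise)
next
  case ("axiom" \<gamma>)
  then show ?case by (intro derives_weaken derives_axiom)
next
  case (mp \<gamma> \<delta>)
  then show ?case
    by (rule derives_mp[OF derives_mp[OF derives_axiom[OF nbI_axiom.S]]])
qed

lemma derives_mono:
  assumes "\<Gamma> \<turnstile>\<^sub>n\<^sub>b\<^sub>I \<alpha>" and "\<Gamma> \<subseteq> \<Delta>"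
  shows "\<Delta> \<turnstile>\<^sub>n\<^sub>b\<^sub>I \<alpha>"
  using assms(1)
proof (induction rule: derives_induct)
  case (premise \<alpha>)
  with assms(2) show ?case by (intro derives_premise) blast
next
  case ("axiom" \<alpha>)
  then show ?case by (rule derives_axiom)
next
  case (mp \<alpha> \<beta>)
  then show ?case by (rule derives_mp)
qed

text \<open>Finiteness of derivations in the form that Zorn's lemma needs: the larger of the two members
  obtained for the premises of a Modus Ponens step serves for its conclusion.\<close>

lemma derives_Union_chain:
  assumes "\<Union>C \<turnstile>\<^sub>n\<^sub>b\<^sub>I \<phi>" and "subset.chain A C" and "C \<noteq> {}"
  shows "\<exists>\<Delta>\<in>C. \<Delta> \<turnstile>\<^sub>n\<^sub>b\<^sub>I \<phi>"
  using assms(1)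
proof (induction rule: derives_induct)
  case (premise \<alpha>)
  then show ?case using derives_premise by blast
next
  case ("axiom" \<alpha>)
  then show ?case using assms(3) derives_axiom by blast
next
  case (mp \<alpha> \<beta>)
  then obtain \<Delta> \<Theta> where \<Delta>: "\<Delta> \<in> C" "\<Delta> \<turnstile>\<^sub>n\<^sub>b\<^sub>I \<alpha> \<^bold>\<rightarrow> \<beta>" and \<Theta>: "\<Theta> \<in> C" "\<Theta> \<turnstile>\<^sub>n\<^sub>b\<^sub>I \<alpha>"
    by blast
  from assms(2) \<Delta>(1) \<Theta>(1) have "\<Delta> \<subseteq> \<Theta> \<or> \<Theta> \<subseteq> \<Delta>"
    by (auto simp: subset_chain_def)
  then show ?case using \<Delta> \<Theta> derives_mono derives_mp by metis
qed

definition saturated :: "'v fm \<Rightarrow> 'v fm set \<Rightarrow> bool" where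
  "saturated \<phi> \<Delta> \<longleftrightarrow> \<not> \<Delta> \<turnstile>\<^sub>n\<^sub>b\<^sub>I \<phi> \<and> (\<forall>\<alpha>. \<alpha> \<notin> \<Delta> \<longrightarrow> insert \<alpha> \<Delta> \<turnstile>\<^sub>n\<^sub>b\<^sub>I \<phi>)"

lemma lindenbaum:
  assumes "\<not> \<Gamma> \<turnstile>\<^sub>n\<^sub>b\<^sub>I \<phi>"
  obtains \<Delta> where "\<Gamma> \<subseteq> \<Delta>" and "saturated \<phi> \<Delta>"
proof -
  let ?A = "{\<Delta>. \<Gamma> \<subseteq> \<Delta> \<and> \<not> \<Delta> \<turnstile>\<^sub>n\<^sub>b\<^sub>I \<phi>}"
  have "?A \<noteq> {}" using assms by auto
  moreover have "\<Union>C \<in> ?A" if "C \<noteq> {}" "subset.chain ?A C" for C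
    using that derives_Union_chain[OF _ that(2,1)] by (auto simp: subset_chain_def)
  ultimately obtain \<Delta> where \<Delta>: "\<Delta> \<in> ?A" and max: "\<forall>X\<in>?A. \<Delta> \<subseteq> X \<longrightarrow> X = \<Delta>"
    using subset_Zorn_nonempty[of ?A] by blast
  have "insert \<alpha> \<Delta> \<turnstile>\<^sub>n\<^sub>b\<^sub>I \<phi>" if "\<alpha> \<notin> \<Delta>" for \<alpha>
    using \<Delta> max that by blast
  with \<Delta> that show thesis unfolding saturated_def by blast
qed

lemma saturated_iff_not_impl:
  assumes "saturated \<phi> \<Delta>"
  shows "\<alpha> \<in> \<Delta> \<longleftrightarrow> \<not> \<Delta> \<turnstile>\<^sub>n\<^sub>b\<^sub>I \<alpha> \<^bold>\<rightarrow> \<phi>"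
  using assms deduction derives_mp derives_premise unfolding saturated_def by blast

lemma saturated_closed:
  assumes "saturated \<phi> \<Delta>"
  shows "\<Delta> \<turnstile>\<^sub>n\<^sub>b\<^sub>I \<alpha> \<longleftrightarrow> \<alpha> \<in> \<Delta>"
  using assms saturated_iff_not_impl[OF assms] derives_mp derives_premise
  unfolding saturated_def by blast

text \<open>Axiom by axiom, saturation turns derivability into the clauses of a bivaluation. Primeness
  comes first, since \<open>(\<alpha> \<rightarrow> \<beta>) \<or> \<alpha>\<close> and \<open>\<alpha> \<or> \<not>\<alpha>\<close> act on membership only through it.\<close>

lemma saturated_bivaluation:
  assumes sat: "saturated \<phi> \<Delta>"
  shows "nbI_bivaluation (\<lambda>\<alpha>. \<alpha> \<in> \<Delta>)"
proof -
  have ax: "nbI_axiom \<alpha> \<Longrightarrow> \<alpha> \<in> \<Delta>" for \<alpha>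
    using derives_axiom saturated_closed[OF sat] by blast
  have mp: "\<alpha> \<^bold>\<rightarrow> \<beta> \<in> \<Delta> \<Longrightarrow> \<alpha> \<in> \<Delta> \<Longrightarrow> \<beta> \<in> \<Delta>" for \<alpha> \<beta>
    using derives_mp saturated_closed[OF sat] by blast
  have not_\<phi>: "\<phi> \<notin> \<Delta>"
    using sat derives_premise unfolding saturated_def by blast
  have out: "\<alpha> \<^bold>\<rightarrow> \<phi> \<in> \<Delta>" if "\<alpha> \<notin> \<Delta>" for \<alpha>
    using that saturated_iff_not_impl[OF sat] saturated_closed[OF sat] by blast
  have prime: "\<alpha> \<in> \<Delta> \<or> \<beta> \<in> \<Delta>" if "\<alpha> \<^bold>\<or> \<beta> \<in> \<Delta>" for \<alpha> \<beta>
  proof (rule ccontr)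
    assume "\<not> (\<alpha> \<in> \<Delta> \<or> \<beta> \<in> \<Delta>)"
    then have "\<alpha> \<^bold>\<rightarrow> \<phi> \<in> \<Delta>" and "\<beta> \<^bold>\<rightarrow> \<phi> \<in> \<Delta>"
      by (simp_all add: out)
    then have "\<phi> \<in> \<Delta>"
      using mp[OF mp[OF mp[OF ax[OF nbI_axiom.DisjE]]]] that by metis
    with not_\<phi> show False ..
  qed
  show ?thesis
    unfolding nbI_bivaluation_def
  proof (intro allI conjI)
    fix \<alpha> \<beta>
    show "\<alpha> \<^bold>\<or> \<beta> \<in> \<Delta> \<longleftrightarrow> \<alpha> \<in> \<Delta> \<or> \<beta> \<in> \<Delta>"
      using prime[of \<alpha> \<beta>] mp[OF ax[OF nbI_axiom.DisjI1[of \<alpha> \<beta>]]]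
        mp[OF ax[OF nbI_axiom.DisjI2[of \<beta> \<alpha>]]] by argo
    show "\<alpha> \<^bold>\<and> \<beta> \<in> \<Delta> \<longleftrightarrow> \<alpha> \<in> \<Delta> \<and> \<beta> \<in> \<Delta>"
      using mp[OF mp[OF ax[OF nbI_axiom.ConjI[of \<alpha> \<beta>]]]]
        mp[OF ax[OF nbI_axiom.ConjE1[of \<alpha> \<beta>]]] mp[OF ax[OF nbI_axiom.ConjE2[of \<alpha> \<beta>]]] by argo
    show "\<alpha> \<^bold>\<rightarrow> \<beta> \<in> \<Delta> \<longleftrightarrow> \<not> \<alpha> \<in> \<Delta> \<or> \<beta> \<in> \<Delta>"
      using mp[of \<alpha> \<beta>] prime[OF ax[OF nbI_axiom.ImplDisj[of \<alpha> \<beta>]]]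
        mp[OF ax[OF nbI_axiom.K[of \<beta> \<alpha>]]] by argo
    \<comment> \<open>If all three were in \<open>\<Delta>\<close>, the explosion axiom would put \<open>\<phi>\<close> itself there.\<close>
    show "\<alpha> \<^bold>\<up> \<beta> \<in> \<Delta> \<longrightarrow> \<not> \<alpha> \<in> \<Delta> \<or> \<not> \<beta> \<in> \<Delta>"
      using mp[OF mp[OF mp[OF ax[OF nbI_axiom.Ip[of \<alpha> \<beta> \<phi>]]]]] not_\<phi> by argo
    show "(\<alpha> \<^bold>\<up> \<beta> \<in> \<Delta>) = (\<beta> \<^bold>\<up> \<alpha> \<in> \<Delta>)"
      using mp[OF ax[OF nbI_axiom.Comm[of \<alpha> \<beta>]]] mp[OF ax[OF nbI_axiom.Comm[of \<beta> \<alpha>]]] by argo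
    show "\<not> \<^bold>\<not> \<alpha> \<in> \<Delta> \<longrightarrow> \<alpha> \<in> \<Delta>"
      using prime[OF ax[OF nbI_axiom.ExcMid[of \<alpha>]]] by argo
  qed
qed

section \<open>Completeness and the restricted matrix\<close>

lemma nbI_completeness:
  assumes "\<Gamma> \<Turnstile>\<^sub>n\<^sub>b\<^sub>I \<phi>"
  shows "\<Gamma> \<turnstile>\<^sub>n\<^sub>b\<^sub>I \<phi>"
proof (rule ccontr)
  assume "\<not> \<Gamma> \<turnstile>\<^sub>n\<^sub>b\<^sub>I \<phi>"
  then obtain \<Delta> where "\<Gamma> \<subseteq> \<Delta>" and sat: "saturated \<phi> \<Delta>"
    by (rule lindenbaum)
  then have "\<phi> \<in> \<Delta>"
    using assms saturated_bivaluation unfolding nbI_entails_def by blast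
  with sat show False
    unfolding saturated_def using derives_premise by blast
qed

lemma valuations_two_nbI_eq: "valuations_two_nbI = Collect nbI_bivaluation"
  unfolding valuations_two_nbI_def valuation_over_def nbI_bivaluation_def two_nbI_def
  by (auto split: if_splits)

lemma M2_nbI_entails_iff: "\<Gamma> \<Turnstile>[M2_nbI] \<phi> \<longleftrightarrow> \<Gamma> \<Turnstile>\<^sub>n\<^sub>b\<^sub>I \<phi>"
  by (simp add: rnmatrix_entails_def nbI_entails_def M2_nbI_def valuations_two_nbI_eq)

theorem corollary2:
  fixes \<Gamma> :: "('v::countable) fm set" and \<phi> :: "'v fm"
  shows "(\<Gamma> \<Turnstile>\<^sub>n\<^sub>b\<^sub>I \<phi> \<longleftrightarrow> \<Gamma> \<Turnstile>[M2_nbI] \<phi>) \<and> (\<Gamma> \<turnstile>\<^sub>n\<^sub>b\<^sub>I \<phi> \<longleftrightarrow> \<Gamma> \<Turnstile>[M2_nbI] \<phi>)"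
  using nbI_soundness nbI_completeness by (auto simp: M2_nbI_entails_iff)

end
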